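(* Fix an integer $t\ge 3$. For each integer $k\ge 2$ let $W(k,t)$ be the windmill graph, which has $n=k(t-1)+1$ vertices, and let $c_i$ be the coefficient of $x^i$ in $\det(D(W(k,t))-xI)$, where $D$ denotes the distance matrix. Then for every $k\ge 2$ the sequence $(-1)^{n-1}c_0,\ldots,(-1)^{n-1}c_{n-2}$ is unimodal, and as $k\to\infty$ the peak of this sequence occurs at $$\frac{kt(t-1)}{2(t+1)}+O(\log k).$$
   Context: The windmill graph $W(k,t)$ is the block graph formed by joining $k$ cliques $K_t$ of size $t$ at one shared universal vertex (any two of the cliques have exactly this vertex in common, and there are no other edges). The distance matrix $D(G)$ of a connected graph $G$ has $(u,v)$-entry equal to the length of a shortest path between $u$ and $v$. A finite real sequence $a_0,\ldots,a_N$ is unimodal with peak at $m$ if $a_{i-1}\le a_i$ for all $1\le i\le m$ and $a_i\ge a_{i+1}$ for all $m\le i\le N-1$. The implied constant in $O(\log k)$ may depend on the fixed integer $t$. *)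

theory Defs
  imports
    "Graph_Theory.Pair_Digraph"
    "Graph_Theory.Shortest_Path"
    "Jordan_Normal_Form.Determinant"
    "HOL-Library.Landau_Symbols"
begin

text \<open>
  The hub is the vertex \<open>0\<close>; the \<open>i\<close>-th clique consists of the hub together with its own
  \<open>t - 1\<close> consecutive vertices.
\<close>

definition windmill_clique :: "nat \<Rightarrow> nat \<Rightarrow> nat set" where
  "windmill_clique t i = insert 0 {i * (t - 1) + 1..(i + 1) * (t - 1)}"

text \<open>Undirected edges are represented by pairs of opposite arcs.\<close>

definition windmill :: "nat \<Rightarrow> nat \<Rightarrow> nat pair_pre_digraph" where
  "windmill k t =
     \<lparr> pverts = {0..<k * (t - 1) + 1},
       parcs = (\<Union>i<k. {(u, v). u \<in> windmill_clique t i \<and> v \<in> windmill_clique t i \<and> u \<noteq> v}) \<rparr>"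

text \<open>With unit weights the cost of a walk is its length.\<close>

definition graph_dist :: "('a, 'b) pre_digraph \<Rightarrow> 'a \<Rightarrow> 'a \<Rightarrow> real" where
  "graph_dist G u v = real_of_ereal (wf_digraph.\<mu> G (\<lambda>_. 1) u v)"

text \<open>Meaningful only for connected graphs whose vertex set is \<open>{0..<n}\<close> for some \<open>n\<close>.\<close>

definition distance_matrix :: "(nat, 'b) pre_digraph \<Rightarrow> real mat" where
  "distance_matrix G = mat (card (verts G)) (card (verts G)) (\<lambda>(u, v). graph_dist G u v)"

text \<open>
  The polynomial \<open>det (A - x I)\<close>; it differs from the library's \<open>char_poly\<close>, which is
  \<open>det (x I - A)\<close>, by the sign \<open>(-1)\<close> to the power of the dimension.
\<close>

definition det_minus_xI :: "real mat \<Rightarrow> real poly" where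
  "det_minus_xI A = det (map_mat (\<lambda>a. [:a:]) A - [:0, 1:] \<cdot>\<^sub>m 1\<^sub>m (dim_row A))"

text \<open>The sequence is \<open>a 0, \<dots>, a N\<close>; the peak need not be unique.\<close>

definition unimodal_with_peak :: "(nat \<Rightarrow> real) \<Rightarrow> nat \<Rightarrow> nat \<Rightarrow> bool" where
  "unimodal_with_peak a N m \<longleftrightarrow>
     m \<le> N \<and> (\<forall>i. 1 \<le> i \<and> i \<le> m \<longrightarrow> a (i - 1) \<le> a i) \<and> (\<forall>i. m \<le> i \<and> i < N \<longrightarrow> a i \<ge> a (i + 1))"

definition unimodal :: "(nat \<Rightarrow> real) \<Rightarrow> nat \<Rightarrow> bool" where
  "unimodal a N \<longleftrightarrow> (\<exists>m. unimodal_with_peak a N m)"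

lemma windmill_clique_card: "card (windmill_clique t i) = t" if "t \<ge> 1"
  using that by (auto simp: windmill_clique_def)

lemma windmill_clique_Int:
  assumes "i \<noteq> j"
  shows "windmill_clique t i \<inter> windmill_clique t j = {0}"
proof -
  have "False" if "i < j" "x \<le> (i + 1) * (t - 1)" "j * (t - 1) + 1 \<le> x" for i j x :: nat
    using that mult_le_mono1[of "i + 1" j "t - 1"] by linarith
  then show ?thesis
    using assms by (fastforce simp: windmill_clique_def nat_neq_iff)
qed

lemma windmill_clique_Union:
  assumes "k \<ge> 1" "t \<ge> 2"
  shows "(\<Union>i<k. windmill_clique t i) = pverts (windmill k t)"
proof (intro equalityI subsetI)
  fix x assume "x \<in> (\<Union>i<k. windmill_clique t i)"
  then obtain i where i: "i < k" "x \<in> windmill_clique t i"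
    by blast
  moreover have "(i + 1) * (t - 1) \<le> k * (t - 1)"
    using i(1) by (intro mult_le_mono1) simp
  moreover have "x \<le> (i + 1) * (t - 1)"
    using i(2) by (auto simp: windmill_clique_def)
  ultimately show "x \<in> pverts (windmill k t)"
    by (simp add: windmill_def)
next
  fix x assume x: "x \<in> pverts (windmill k t)"
  show "x \<in> (\<Union>i<k. windmill_clique t i)"
  proof (cases "x = 0")
    case True
    with assms show ?thesis by (intro UN_I[of 0]) (auto simp: windmill_clique_def)
  next
    case False
    define i where "i = (x - 1) div (t - 1)"
    have "i * (t - 1) + (x - 1) mod (t - 1) = x - 1"
      unfolding i_def by (rule div_mult_mod_eq)
    moreover have "(x - 1) mod (t - 1) < t - 1" using assms by simp
    moreover have "i < k"
      unfolding i_def using x False assms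
      by (subst div_less_iff_less_mult) (auto simp: windmill_def)
    ultimately show ?thesis
      using False by (intro UN_I[of i]) (simp_all add: windmill_clique_def, linarith)
  qed
qed

lemma card_windmill: "card (pverts (windmill k t)) = k * (t - 1) + 1"
  by (simp add: windmill_def)

lemma pair_graph_windmill:
  assumes "t \<ge> 2"
  shows "pair_graph (windmill k t)"
proof
  have *: "u \<in> pverts (windmill k t) \<and> v \<in> pverts (windmill k t)"
    if "(u, v) \<in> parcs (windmill k t)" for u v
  proof -
    from that have "k \<ge> 1" by (auto simp: windmill_def)
    with that assms show ?thesis
      by (subst (1 2) windmill_clique_Union[symmetric]) (auto simp: windmill_def)
  qed
  then show "\<And>e. e \<in> parcs (windmill k t) \<Longrightarrow> fst e \<in> pverts (windmill k t)"
    and "\<And>e. e \<in> parcs (windmill k t) \<Longrightarrow> snd e \<in> pverts (windmill k t)"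
    by auto
  show "finite (pverts (windmill k t))" by (simp add: windmill_def)
  then show "finite (parcs (windmill k t))"
    using * by (intro finite_subset[of "parcs (windmill k t)"
      "pverts (windmill k t) \<times> pverts (windmill k t)"] finite_cartesian_product) auto
  show "\<And>e. e \<in> parcs (windmill k t) \<Longrightarrow> fst e \<noteq> snd e"
    by (auto simp: windmill_def)
  show "symmetric (with_proj (windmill k t))"
    by (auto simp: symmetric_def windmill_def sym_def)
qed

end

theory Submission
  imports Defs "HOL-Computational_Algebra.Fundamental_Theorem_Algebra"
begin

text \<open>
  Write \<open>N = k (t - 1) - 1\<close>. The distance matrix has many obvious eigenvectors that vanish at the
  hub and have sum zero: those supported on one clique belong to the eigenvalue \<open>-1\<close>, and those
  constant on the non-hub vertices of each clique to \<open>-t\<close>. What remains is a two-dimensional space,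
  and up to sign the characteristic polynomial is \<open>(1 + x) ^ (k (t - 2)) * (t + x) ^ (k - 1) * (k (t - 1)
  + (2 k (t - 1) - t) x - x\<^sup>2)\<close> (lemma \<open>det_minus_xI_windmill\<close>). Instead of
  eigenvectors the proof uses an explicit triangular factorisation.

  All roots of this polynomial are real. By Newton's inequality its coefficients \<open>a i\<close> are
  therefore log-concave (\<open>real_rooted_log_concave\<close>), and since they are positive for \<open>i \<le>
  N\<close> (\<open>windmill_coeff_pos\<close>), they are unimodal there. Newton's inequality follows from
  Laguerre's inequality together with the fact that derivatives of real-rooted polynomials are real-rooted.

  For the position of the peak, let \<open>b i\<close> be the coefficients of the product of the two powers.
  They are log-concave and satisfy a recurrence that relates three neighbours. Inserting log-concavity into the
  recurrence turns it into an inequality between two neighbours, which shows that \<open>b\<close> increases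
  before its mean and decreases after it, up to a bounded shift (\<open>coeff_binomial_product_increase\<close>,
  \<open>coeff_binomial_product_decrease\<close>). The quadratic factor shifts indices by at most two, and its
  negative leading coefficient is dominated by the other two, so the same holds for \<open>a\<close>. Any peak
  thus lies at distance at most \<open>4\<close> from \<open>k t (t - 1) / (2 (t + 1))\<close>
  (\<open>windmill_peak_bound\<close>): the error is even bounded.
\<close>

section \<open>Real-rooted polynomials and Newton's inequality\<close>

text \<open>
  Nonzero real polynomials that split into linear factors over the reals. The inductive form makes statements
  about all of them provable by adjoining one root at a time.
\<close>

inductive real_rooted :: "real poly \<Rightarrow> bool" where
  const: "c \<noteq> 0 \<Longrightarrow> real_rooted [:c:]"
| linear: "real_rooted p \<Longrightarrow> real_rooted ([:- r, 1:] * p)"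

abbreviation complex_poly :: "real poly \<Rightarrow> complex poly" where
  "complex_poly \<equiv> map_poly of_real"

lemma complex_poly_mult: "complex_poly (p * q) = complex_poly p * complex_poly q"
  by (rule poly_eqI) (simp add: coeff_map_poly coeff_mult)

lemma complex_poly_linear: "complex_poly [:- r, 1:] = [:- of_real r, 1:]"
  by (simp add: map_poly_pCons)

lemma poly_complex_poly_of_real: "poly (complex_poly p) (of_real x) = of_real (poly p x)"
  by (induction p) (simp_all add: map_poly_pCons)

lemma complex_poly_pderiv: "complex_poly (pderiv p) = pderiv (complex_poly p)"
  by (rule poly_eqI) (simp add: coeff_pderiv coeff_map_poly)

lemma real_rooted_mult:
  assumes "real_rooted p" "real_rooted q"
  shows "real_rooted (p * q)"
  using assms(1)
proof (induction rule: real_rooted.induct)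
  case (const c)
  from assms(2) show ?case
  proof (induction rule: real_rooted.induct)
    case (const d)
    with \<open>c \<noteq> 0\<close> show ?case by (simp add: real_rooted.const)
  next
    case (linear p r)
    then show ?case by (metis mult.left_commute real_rooted.linear)
  qed
next
  case (linear p r)
  then show ?case by (metis mult.assoc real_rooted.linear)
qed

lemma real_rooted_power: "real_rooted p \<Longrightarrow> real_rooted (p ^ n)"
  by (induction n) (auto simp: one_pCons intro: real_rooted.const real_rooted_mult)

text \<open>
  By the fundamental theorem of algebra there is a complex root, which by assumption is real, so that it can be
  divided out over the reals.
\<close>

lemma real_rootedI:
  assumes "p \<noteq> 0" "\<And>z. poly (complex_poly p) z = 0 \<Longrightarrow> Im z = 0"
  shows "real_rooted p"
  using assms
proof (induction "degree p" arbitrary: p)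
  case 0
  then obtain c where "p = [:c:]" by (metis degree_eq_zeroE)
  with 0 show ?case by (auto intro: real_rooted.const)
next
  case (Suc d)
  have "degree (complex_poly p) \<noteq> 0" using Suc.hyps(2) by (simp add: degree_map_poly)
  then obtain z where z: "poly (complex_poly p) z = 0"
    using fundamental_theorem_of_algebra[of "complex_poly p"] constant_degree by metis
  define r where "r = Re z"
  have "z = of_real r" using Suc.prems(2)[OF z] by (simp add: r_def complex_eq_iff)
  with z have "poly p r = 0" by (simp add: poly_complex_poly_of_real)
  then obtain q where q: "p = [:- r, 1:] * q" by (metis dvdE poly_eq_0_iff_dvd)
  have "real_rooted q"
  proof (rule Suc.hyps(1))
    have "q \<noteq> 0" using q Suc.prems(1) by auto
    then show "q \<noteq> 0" .
    have "degree p = Suc (degree q)" using \<open>q \<noteq> 0\<close> unfolding q by (subst degree_mult_eq) auto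
    with Suc.hyps(2) show "d = degree q" by simp
    show "Im w = 0" if "poly (complex_poly q) w = 0" for w
      using that by (intro Suc.prems(2)) (simp only: q complex_poly_mult poly_mult mult_zero_right)
  qed
  then show ?case unfolding q by (rule real_rooted.linear)
qed

text \<open>
  The half-plane form of the Gauss--Lucas theorem. If \<open>p\<close> has the real roots
  \<open>r\<^sub>j\<close>, then \<open>p' / p = (\<Sum>j. 1 / (z - r\<^sub>j))\<close>, and every summand has
  an imaginary part of sign opposite to \<open>Im z\<close>. Multiplication by
  \<open>\<bar>p\<bar>\<^sup>2\<close> avoids the division, and a new root only adds another term of the same
  sign. The three claims are conjoined because the induction needs them together.
\<close>

lemma real_rooted_log_derivative:
  assumes "real_rooted p"
  shows "Im z * Im (poly (complex_poly (pderiv p)) z * cnj (poly (complex_poly p) z)) \<le> 0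
    \<and> (Im z \<noteq> 0 \<longrightarrow> poly (complex_poly p) z \<noteq> 0)
    \<and> (Im z \<noteq> 0 \<longrightarrow> degree p > 0 \<longrightarrow> poly (complex_poly (pderiv p)) z \<noteq> 0)"
  using assms
proof (induction rule: real_rooted.induct)
  case (const c)
  then show ?case by (simp add: map_poly_pCons pderiv_pCons)
next
  case (linear p r)
  let ?P = "poly (complex_poly p) z" and ?P' = "poly (complex_poly (pderiv p)) z"
  let ?w = "z - of_real r"
  have val: "poly (complex_poly ([:- r, 1:] * p)) z = ?w * ?P"
    by (simp only: complex_poly_mult complex_poly_linear) (simp add: algebra_simps)
  have der: "poly (complex_poly (pderiv ([:- r, 1:] * p))) z = ?P + ?w * ?P'"
    unfolding complex_poly_pderiv complex_poly_mult complex_poly_linear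
    by (simp add: pderiv_mult pderiv_pCons del: mult_pCons_left)
  have "(?P + ?w * ?P') * cnj (?w * ?P)
      = of_real ((cmod ?P)\<^sup>2) * cnj ?w + of_real ((cmod ?w)\<^sup>2) * (?P' * cnj ?P)"
    unfolding complex_norm_square by (simp add: algebra_simps)
  then have "Im ((?P + ?w * ?P') * cnj (?w * ?P))
      = - (cmod ?P)\<^sup>2 * Im z + (cmod ?w)\<^sup>2 * Im (?P' * cnj ?P)"
    by (simp only: plus_complex.sel Im_complex_of_real Re_complex_of_real times_complex.sel(2)) simp
  then have eq: "Im z * Im ((?P + ?w * ?P') * cnj (?w * ?P))
      = - (cmod ?P * Im z)\<^sup>2 + (cmod ?w)\<^sup>2 * (Im z * Im (?P' * cnj ?P))"
    by (simp only:) (simp only: algebra_simps power2_eq_square)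
  have le: "(cmod ?w)\<^sup>2 * (Im z * Im (?P' * cnj ?P)) \<le> 0"
    using linear.IH by (simp add: mult_nonneg_nonpos)
  have neg: "Im z * Im ((?P + ?w * ?P') * cnj (?w * ?P)) < 0" if "Im z \<noteq> 0"
  proof -
    have "(cmod ?P * Im z)\<^sup>2 > 0" using linear.IH that by simp
    with eq le show ?thesis by linarith
  qed
  have "Im z * Im ((?P + ?w * ?P') * cnj (?w * ?P)) \<le> 0"
    using neg by (cases "Im z = 0") (auto simp: less_imp_le)
  moreover have "?w * ?P \<noteq> 0" if "Im z \<noteq> 0" using linear.IH that by auto
  moreover have "?P + ?w * ?P' \<noteq> 0" if "Im z \<noteq> 0"
  proof
    assume zero: "?P + ?w * ?P' = 0"
    from neg[OF that] show False unfolding zero by simp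
  qed
  ultimately show ?case unfolding val der by blast
qed

lemma real_rooted_pderiv:
  assumes "real_rooted p" "degree p > 0"
  shows "real_rooted (pderiv p)"
proof (rule real_rootedI)
  show "pderiv p \<noteq> 0" using assms(2) by (simp add: pderiv_eq_0_iff)
  show "Im z = 0" if "poly (complex_poly (pderiv p)) z = 0" for z
    using real_rooted_log_derivative[OF assms(1)] assms(2) that by blast
qed

text \<open>
  Laguerre's inequality: at points other than roots it says that the derivative of \<open>p' / p = (\<Sum>j. 1 /
  (x - r\<^sub>j))\<close> is not positive. Adjoining a root \<open>r\<close> multiplies the discrepancy between
  the two sides by \<open>(x - r)\<^sup>2\<close> and adds \<open>(p x)\<^sup>2\<close>.
\<close>

lemma real_rooted_laguerre:
  assumes "real_rooted p"
  shows "poly p x * poly (pderiv (pderiv p)) x \<le> (poly (pderiv p) x)\<^sup>2"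
  using assms
proof (induction rule: real_rooted.induct)
  case (const c)
  then show ?case by (simp add: pderiv_pCons)
next
  case (linear p r)
  let ?w = "x - r"
  have d0: "poly ([:- r, 1:] * p) x = ?w * poly p x" by (simp add: algebra_simps)
  have d1: "poly (pderiv ([:- r, 1:] * p)) x = poly p x + ?w * poly (pderiv p) x"
    by (simp add: pderiv_mult pderiv_pCons del: mult_pCons_left)
  have d2: "poly (pderiv (pderiv ([:- r, 1:] * p))) x
      = 2 * poly (pderiv p) x + ?w * poly (pderiv (pderiv p)) x"
    by (simp add: pderiv_mult pderiv_pCons pderiv_add del: mult_pCons_left)
  have "0 \<le> (poly p x)\<^sup>2 + ?w\<^sup>2 * ((poly (pderiv p) x)\<^sup>2 - poly p x * poly (pderiv (pderiv p)) x)"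
    using linear.IH by simp
  then show ?case unfolding d0 d1 d2 by (simp add: algebra_simps power2_eq_square)
qed

text \<open>
  Newton's inequality is Laguerre's inequality at \<open>0\<close> for the derivatives of \<open>p\<close>:
  these are again real-rooted, and their lowest three coefficients are those of \<open>p\<close> up to
  factorials. These factorials account for the factors \<open>i + 1\<close> and \<open>i + 2\<close>, with which
  the inequality for \<open>p'\<close> at \<open>i\<close> is exactly the inequality for \<open>p\<close> at
  \<open>i + 1\<close>.
\<close>

lemma newton_inequality:
  assumes "real_rooted p"
  shows "(real i + 2) * (coeff p i * coeff p (i + 2)) \<le> (real i + 1) * (coeff p (i + 1))\<^sup>2"
  using assms
proof (induction i arbitrary: p)
  case 0
  from real_rooted_laguerre[OF 0, of 0] show ?case
    by (simp add: poly_0_coeff_0 coeff_pderiv numeral_2_eq_2)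
next
  case (Suc i)
  show ?case
  proof (cases "degree p > 0")
    case True
    let ?c = "(real i + 1) * (real i + 2)"
    from Suc.IH[OF real_rooted_pderiv[OF Suc.prems True]]
    have "?c * ((real i + 3) * (coeff p (i + 1) * coeff p (i + 3)))
        \<le> ?c * ((real i + 2) * (coeff p (i + 2))\<^sup>2)"
      by (simp add: coeff_pderiv algebra_simps power2_eq_square eval_nat_numeral)
    moreover have "?c > 0" by (simp add: add_pos_nonneg)
    ultimately have "(real i + 3) * (coeff p (i + 1) * coeff p (i + 3))
        \<le> (real i + 2) * (coeff p (i + 2))\<^sup>2"
      by (simp only: mult_le_cancel_left_pos)
    then show ?thesis by (simp add: eval_nat_numeral algebra_simps)
  next
    case False
    then show ?thesis by (simp add: coeff_eq_0)
  qed
qed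

lemma real_rooted_log_concave:
  assumes "real_rooted p"
  shows "coeff p i * coeff p (i + 2) \<le> (coeff p (i + 1))\<^sup>2"
proof -
  have "(real i + 2) * (coeff p i * coeff p (i + 2)) \<le> (real i + 2) * (coeff p (i + 1))\<^sup>2"
    by (rule order_trans[OF newton_inequality[OF assms]], rule mult_right_mono) simp_all
  moreover have "real i + 2 > 0" by simp
  ultimately show ?thesis by (simp only: mult_le_cancel_left_pos)
qed

text \<open>
  Once a positive log-concave sequence has descended strictly, it must keep descending, because the quotients of
  neighbours do not increase. The first strict descent is therefore a peak.
\<close>

lemma log_concave_unimodal:
  fixes a :: "nat \<Rightarrow> real"
  assumes pos: "\<And>i. i \<le> N \<Longrightarrow> a i > 0"
    and lc: "\<And>i. i + 2 \<le> N \<Longrightarrow> a i * a (i + 2) \<le> (a (i + 1))\<^sup>2"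
  shows "unimodal a N"
proof -
  define m where "m = (LEAST m. m = N \<or> a (m + 1) < a m)"
  have m: "m = N \<or> a (m + 1) < a m" unfolding m_def by (rule LeastI[of _ N]) simp
  have least: "\<not> (j = N \<or> a (j + 1) < a j)" if "j < m" for j
    using that unfolding m_def by (rule not_less_Least)
  have "m \<le> N" unfolding m_def by (rule Least_le) simp
  have "a (i - 1) \<le> a i" if "1 \<le> i" "i \<le> m" for i
    using least[of "i - 1"] that by fastforce
  moreover have "a (i + 1) < a i" if "m \<le> i" "i < N" for i
    using that
  proof (induction i rule: dec_induct)
    case base
    then show ?case using m by simp
  next
    case (step i)
    have "a (i + 1) < a i" using step by simp
    have "a i * a (i + 2) \<le> a (i + 1) * a (i + 1)"
      using lc[of i] step.prems by (simp add: power2_eq_square)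
    also have "\<dots> < a i * a (i + 1)"
      using \<open>a (i + 1) < a i\<close> pos[of "i + 1"] step.prems by simp
    finally show ?case using pos[of i] step.prems by simp
  qed
  ultimately have "unimodal_with_peak a N m"
    using \<open>m \<le> N\<close> unfolding unimodal_with_peak_def by (auto intro: less_imp_le)
  then show ?thesis unfolding unimodal_def by blast
qed

section \<open>Distances in the windmill graph\<close>

lemma graph_dist_eqI:
  assumes "wf_digraph G" and walk: "pre_digraph.awalk G u p v"
    and shortest: "\<And>q. pre_digraph.awalk G u q v \<Longrightarrow> length p \<le> length q"
  shows "graph_dist G u v = real (length p)"
proof -
  interpret wf_digraph G by fact
  have cost: "awalk_cost (\<lambda>_. 1) q = real (length q)" for q :: "'b list"
    by (induction q) auto
  have "\<mu> (\<lambda>_. 1) u v = ereal (real (length p))"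
    unfolding \<mu>_def cost using walk shortest by (intro antisym INF_lower INF_greatest) auto
  then show ?thesis unfolding graph_dist_def by simp
qed

lemma mem_windmill_clique_iff:
  assumes "t \<ge> 2"
  shows "u \<in> windmill_clique t i \<longleftrightarrow> u = 0 \<or> (u - 1) div (t - 1) = i"
proof (cases u)
  case 0
  then show ?thesis by (simp add: windmill_clique_def)
next
  case (Suc v)
  have "v div (t - 1) = i \<longleftrightarrow> i * (t - 1) \<le> v \<and> v < (i + 1) * (t - 1)"
  proof
    assume "v div (t - 1) = i"
    then show "i * (t - 1) \<le> v \<and> v < (i + 1) * (t - 1)"
      using assms dividend_less_div_times[of "t - 1" v] div_times_less_eq_dividend[of v "t - 1"]
      by auto
  next
    assume "i * (t - 1) \<le> v \<and> v < (i + 1) * (t - 1)"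
    then show "v div (t - 1) = i" by (intro div_nat_eqI) (simp_all add: mult.commute)
  qed
  then show ?thesis using Suc by (auto simp: windmill_clique_def)
qed

lemma windmill_arc_iff:
  assumes "t \<ge> 2" "k \<ge> 1" "u < k * (t - 1) + 1" "v < k * (t - 1) + 1"
  shows "(u, v) \<in> parcs (windmill k t) \<longleftrightarrow>
    u \<noteq> v \<and> (u = 0 \<or> v = 0 \<or> (u - 1) div (t - 1) = (v - 1) div (t - 1))"
proof -
  have "(w - 1) div (t - 1) < k" if "w < k * (t - 1) + 1" for w
  proof -
    have "0 < k * (t - 1)" using assms(1,2) by simp
    with that assms(1) show ?thesis by (subst div_less_iff_less_mult) linarith+
  qed
  with assms(3,4) have "(u - 1) div (t - 1) < k" "(v - 1) div (t - 1) < k" by blast+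
  with assms(2) show ?thesis
    by (auto simp: windmill_def mem_windmill_clique_iff[OF assms(1)])
qed

text \<open>
  Two vertices that are not adjacent lie in different cliques, and the walk through the hub joins them in two
  steps.
\<close>

lemma graph_dist_windmill:
  assumes "t \<ge> 2" "k \<ge> 1" "u < k * (t - 1) + 1" "v < k * (t - 1) + 1"
  shows "graph_dist (with_proj (windmill k t)) u v =
    (if u = v then 0
     else if u = 0 \<or> v = 0 \<or> (u - 1) div (t - 1) = (v - 1) div (t - 1) then 1 else 2)"
proof -
  interpret pair_graph "windmill k t" using assms(1) by (rule pair_graph_windmill)
  let ?G = "with_proj (windmill k t)"
  have wf: "wf_digraph ?G" by unfold_locales
  have verts: "w \<in> pverts (windmill k t)" if "w < k * (t - 1) + 1" for w
    using that by (simp add: windmill_def)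
  note arc = windmill_arc_iff[OF assms(1,2)]
  consider "u = v" | "u \<noteq> v" "(u, v) \<in> parcs (windmill k t)"
    | "u \<noteq> v" "(u, v) \<notin> parcs (windmill k t)" by blast
  then show ?thesis
  proof cases
    case 1
    then have "graph_dist ?G u v = real (length ([] :: (nat \<times> nat) list))"
      using verts[OF assms(3)] by (intro graph_dist_eqI[OF wf]) (auto simp: awalk_Nil_iff)
    with 1 show ?thesis by simp
  next
    case 2
    then have "graph_dist ?G u v = real (length [(u, v)])"
      by (intro graph_dist_eqI[OF wf])
        (auto simp: awalk_Nil_iff awalk_Cons_iff verts[OF assms(4)] Suc_le_eq)
    with 2 show ?thesis using arc[OF assms(3,4)] by simp
  next
    case 3
    with arc[OF assms(3,4)] have nz: "u \<noteq> 0" "v \<noteq> 0"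
      and ncl: "(u - 1) div (t - 1) \<noteq> (v - 1) div (t - 1)" by auto
    have arcs: "(u, 0) \<in> parcs (windmill k t)" "(0, v) \<in> parcs (windmill k t)"
      using arc[of u 0] arc[of 0 v] assms nz by auto
    have "graph_dist ?G u v = real (length [(u, 0), (0, v)])"
    proof (rule graph_dist_eqI[OF wf])
      show "awalk u [(u, 0), (0, v)] v"
        using arcs by (auto simp: awalk_Nil_iff awalk_Cons_iff verts[OF assms(4)])
      fix q assume q: "awalk u q v"
      show "length [(u, 0), (0, v)] \<le> length q"
      proof (rule ccontr)
        assume "\<not> ?thesis"
        then have "q = [] \<or> (\<exists>e. q = [e])" by (cases q) (auto simp: Suc_le_eq)
        with q 3 show False by (auto simp: awalk_Nil_iff awalk_Cons_iff)
      qed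
    qed
    with 3 nz ncl show ?thesis by simp
  qed
qed

section \<open>The characteristic polynomial\<close>

lemma prod_if_dvd:
  fixes a b :: "'a :: comm_monoid_mult"
  assumes "s \<ge> 1"
  shows "(\<Prod>w<k * s. if s dvd w then a else b) = a ^ k * b ^ (k * (s - 1))"
proof -
  have "(\<Prod>w\<in>{m * s..<m * s + s}. if s dvd w then a else b) = a * b ^ (s - 1)" for m
  proof -
    have "{w \<in> {m * s..<m * s + s} - {m * s}. s dvd w} = {}"
    proof -
      have "w = m * s" if "s dvd w" "m * s \<le> w" "w < m * s + s" for w
      proof -
        have "w div s = m" using that by (intro div_nat_eqI) (simp_all add: algebra_simps)
        with \<open>s dvd w\<close> show ?thesis by auto
      qed
      then show ?thesis by auto
    qed
    then have "(\<Prod>w\<in>{m * s..<m * s + s} - {m * s}. if s dvd w then a else b)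
        = (\<Prod>w\<in>{m * s..<m * s + s} - {m * s}. b)"
      by (intro prod.cong refl) auto
    then show ?thesis
      using assms by (subst prod.remove[of _ "m * s"]) (simp_all add: card_Diff_singleton)
  qed
  then show ?thesis
    unfolding prod.nat_group[symmetric]
    by (simp add: power_mult_distrib mult.commute[of k] flip: power_mult)
qed

text \<open>
  The matrix \<open>M = D - x I\<close> is triangularised by combining columns: the sum of the columns of a
  clique, hub excluded, replaces the column of its first vertex (its leader), and \<open>y\<close> times the hub
  column plus \<open>1 + 2 x\<close> times all other columns replaces the hub column. The weights
  \<open>y\<close> and \<open>1 + 2 x\<close> make the new hub column proportional to \<open>(1, 2, \<dots>,
  2)\<close>. In matrix form this is \<open>M * U = L * T\<close>, with \<open>U\<close> and \<open>L\<close>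
  lower triangular and \<open>T\<close> upper triangular. The factor \<open>y\<close> on the left is \<open>det
  U\<close>; keeping it there avoids fractions, so that the identity holds over every commutative ring and can
  be applied to polynomials.
\<close>

lemma det_windmill_matrix:
  fixes k s n :: nat and x :: "'a :: comm_ring_1"
  assumes s: "s \<ge> 1" and n: "n = k * s + 1"
  defines "y \<equiv> x + of_nat s + 1"
  defines "M \<equiv> mat n n (\<lambda>(u, v).
    if u = v then - x else if u = 0 \<or> v = 0 \<or> (u - 1) div s = (v - 1) div s then 1 else 2)"
  shows "y * det M =
    (of_nat (k * s) * (1 + 2 * x) - x * y) * (- y) ^ k * (- (1 + x)) ^ (k * (s - 1))"
proof -
  \<comment> \<open>the value that makes the new hub column \<open>\<delta> * (1, 2, \<dots>, 2)\<close>\<close>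
  define \<delta> where "\<delta> = of_nat (k * s) * (1 + 2 * x) - x * y"
  define same where "same v w \<longleftrightarrow> (v - 1) div s = (w - 1) div s" for v w :: nat
  define lead where "lead w \<longleftrightarrow> s dvd (w - 1)" for w :: nat
  define fst_of where "fst_of w = (w - 1) div s * s + 1" for w :: nat
  define U where "U v w = (if w = 0 then (if v = 0 then y else 1 + 2 * x)
    else if lead w then (if v > 0 \<and> same v w then 1 else 0)
    else (if v = w then 1 else 0))" for v w
  define L where "L v w = (if w = 0 then (if v = 0 then 1 else 2)
    else if lead w then (if v > 0 \<and> same v w then 1 else 0)
    else (if v = w then 1 else 0 :: 'a))" for v w
  define T where "T v w = (if w = 0 then (if v = 0 then \<delta> else 0)
    else if lead w then (if v = 0 then of_nat s else if v = w then - y else 0)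
    else (if v = 0 then 1 else if v = w then - (1 + x) else if v = fst_of w then - 1 else 0))"
    for v w
  define m where "m u v =
    (if u = v then - x else if u = 0 \<or> v = 0 \<or> same u v then 1 else 2)" for u v
  have M: "M = mat n n (\<lambda>(u, v). m u v)"
    unfolding M_def m_def same_def ..

  define C where "C w = {v \<in> {1..<n}. same v w}" for w
  have C_eq: "C w = {fst_of w..<fst_of w + s}" if "w > 0" "w < n" for w
  proof -
    have "(w - 1) div s < k"
    proof -
      have "w - 1 < k * s" using that n by linarith
      then show ?thesis using s by (subst div_less_iff_less_mult) auto
    qed
    then have "((w - 1) div s + 1) * s \<le> k * s" by (intro mult_le_mono1) simp
    then have le: "fst_of w + s \<le> n" unfolding fst_of_def n by (simp add: algebra_simps)
    have "same v w \<longleftrightarrow> fst_of w \<le> v \<and> v < fst_of w + s" if "v > 0" for v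
    proof
      assume "same v w"
      then show "fst_of w \<le> v \<and> v < fst_of w + s"
        unfolding same_def fst_of_def
        using that s dividend_less_div_times[of s "v - 1"] div_times_less_eq_dividend[of "v - 1" s]
        by auto
    next
      assume "fst_of w \<le> v \<and> v < fst_of w + s"
      then have "(w - 1) div s * s \<le> v - 1" "v - 1 < (w - 1) div s * s + s"
        unfolding fst_of_def by linarith+
      then show "same v w" unfolding same_def
        by (intro div_nat_eqI) (simp_all add: algebra_simps)
    qed
    moreover have "fst_of w > 0" by (simp add: fst_of_def)
    ultimately show ?thesis using le unfolding C_def by fastforce
  qed
  have card_C: "card (C w) = s" if "w > 0" "w < n" for w
    using C_eq[OF that] by simp
  have same_sym: "same u v \<longleftrightarrow> same v u" for u v unfolding same_def by auto
  have fst_of: "fst_of w > 0" "fst_of w \<le> w" "same (fst_of w) w" "same w (fst_of w)" "lead (fst_of w)"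
    if "w > 0" for w
  proof -
    have "(w - 1) div s * s \<le> w - 1" by (rule div_times_less_eq_dividend)
    with that show "fst_of w \<le> w" unfolding fst_of_def by linarith
  qed (use s in \<open>auto simp: fst_of_def same_def lead_def\<close>)
  have fst_of_eq: "w = fst_of w" if "lead w" "w > 0" for w
    using that unfolding fst_of_def lead_def by auto

  have sum_nonhub: "(\<Sum>v\<in>{1..<n}. m u v) =
      (if u = 0 then of_nat (k * s) else 2 * of_nat (k * s) - y)" if u: "u < n" for u
  proof (cases "u = 0")
    case True
    then have "(\<Sum>v\<in>{1..<n}. m u v) = (\<Sum>v\<in>{1..<n}. 1)"
      by (intro sum.cong refl) (auto simp: m_def)
    with True n show ?thesis by simp
  next
    case False
    have "(\<Sum>v\<in>{1..<n}. m u v) =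
        (\<Sum>v\<in>{1..<n}. 2 - (if v = u then 1 + x else 0) - (if same v u then 1 else 0))"
      using False by (intro sum.cong refl) (auto simp: m_def same_sym, auto simp: same_def)
    also have "\<dots> = (\<Sum>v\<in>{1..<n}. 2) - (\<Sum>v\<in>{1..<n}. if v = u then 1 + x else 0)
        - (\<Sum>v\<in>C u. 1)"
      unfolding C_def by (simp only: sum_subtractf sum.inter_filter finite_atLeastLessThan)
    also have "(\<Sum>v\<in>C u. 1) = (of_nat s :: 'a)" using False u card_C[of u] by simp
    also have "(\<Sum>v\<in>{1..<n}. 2) = (2 * of_nat (k * s) :: 'a)" using n by simp
    also have "(\<Sum>v\<in>{1..<n}. if v = u then 1 + x else 0) = 1 + x"
      using False u by simp
    finally show ?thesis using False by (simp add: y_def)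
  qed
  have sum_C: "(\<Sum>v\<in>C w. m u v) =
      (if u = 0 then of_nat s else 2 * of_nat s - (if same u w then y else 0))"
    if uw: "u < n" "w > 0" "w < n" for u w
  proof (cases "u = 0")
    case True
    then have "(\<Sum>v\<in>C w. m u v) = (\<Sum>v\<in>C w. 1)"
      by (intro sum.cong refl) (auto simp: m_def C_def)
    with True card_C[OF uw(2,3)] show ?thesis by simp
  next
    case False
    have fin: "finite (C w)" by (simp add: C_def)
    have "(\<Sum>v\<in>C w. m u v) =
        (\<Sum>v\<in>C w. 2 - (if v = u then 1 + x else 0) - (if same u w then 1 else 0))"
      using False by (intro sum.cong refl) (auto simp: m_def C_def same_def)
    also have "\<dots> = 2 * of_nat s - (if u \<in> C w then 1 + x else 0) - (if same u w then of_nat s else 0)"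
      using fin card_C[OF uw(2,3)] by (simp add: sum_subtractf sum.delta')
    also have "u \<in> C w \<longleftrightarrow> same u w" using False uw by (auto simp: C_def)
    finally show ?thesis using False by (simp add: y_def)
  qed

  have prod_eq: "mat n n (\<lambda>(u, v). m u v) * mat n n (\<lambda>(v, w). U v w)
    = mat n n (\<lambda>(u, v). L u v) * mat n n (\<lambda>(v, w). T v w)"
  proof (rule eq_matI)
    fix u w assume "u < dim_row (mat n n (\<lambda>(u, v). L u v) * mat n n (\<lambda>(v, w). T v w))"
      and "w < dim_col (mat n n (\<lambda>(u, v). L u v) * mat n n (\<lambda>(v, w). T v w))"
    then have uw: "u < n" "w < n" by auto
    have split: "{0..<n} = insert 0 {1..<n}" using n by auto
    have LT: "(\<Sum>v\<in>{0..<n}. L u v * T v w) = L u 0 * T 0 w + (\<Sum>v\<in>{1..<n}. L u v * T v w)"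
      unfolding split by simp
    have "(\<Sum>v\<in>{0..<n}. m u v * U v w) = (\<Sum>v\<in>{0..<n}. L u v * T v w)"
    proof (cases "w = 0")
      case True
      have "(\<Sum>v\<in>{0..<n}. m u v * U v w) = m u 0 * y + (\<Sum>v\<in>{1..<n}. m u v * (1 + 2 * x))"
        unfolding split by (simp add: True U_def)
      also have "\<dots> = m u 0 * y + (\<Sum>v\<in>{1..<n}. m u v) * (1 + 2 * x)"
        by (simp only: sum_distrib_right)
      also have "\<dots> = L u 0 * \<delta>"
        unfolding sum_nonhub[OF uw(1)]
        by (cases "u = 0") (simp_all add: m_def L_def \<delta>_def algebra_simps)
      also have "\<dots> = (\<Sum>v\<in>{0..<n}. L u v * T v w)"
        unfolding split by (simp add: True T_def)
      finally show ?thesis .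
    next
      case w: False
      show ?thesis
      proof (cases "lead w")
        case True
        have "(\<Sum>v\<in>{0..<n}. m u v * U v w) = (\<Sum>v\<in>{1..<n}. if same v w then m u v else 0)"
          unfolding split using w True by (simp add: U_def) (intro sum.cong refl, auto)
        also have "\<dots> = (\<Sum>v\<in>C w. m u v)" unfolding C_def by (simp only: sum.inter_filter finite_atLeastLessThan)
        also have "\<dots> = L u 0 * of_nat s - L u w * y"
          using sum_C[of u w] uw w True by (simp add: L_def)
        also have "\<dots> = L u 0 * of_nat s + (\<Sum>v\<in>{1..<n}. if v = w then - (L u w * y) else 0)"
          using uw w by (simp add: sum.delta')
        also have "(\<Sum>v\<in>{1..<n}. if v = w then - (L u w * y) else 0)
            = (\<Sum>v\<in>{1..<n}. L u v * T v w)"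
          using w True by (intro sum.cong refl) (auto simp: T_def)
        also have "L u 0 * of_nat s + \<dots> = (\<Sum>v\<in>{0..<n}. L u v * T v w)"
          unfolding LT using w True by (simp add: T_def)
        finally show ?thesis .
      next
        case False
        have ne: "fst_of w \<noteq> w" using False fst_of(5)[of w] w by auto
        have "(\<Sum>v\<in>{0..<n}. m u v * U v w) = (\<Sum>v\<in>{0..<n}. if v = w then m u w else 0)"
          using w False by (intro sum.cong refl) (auto simp: U_def)
        also have "\<dots> = m u w" using uw by (simp add: sum.delta')
        also have "\<dots> = L u 0 - L u (fst_of w) - (1 + x) * L u w"
          using w False fst_of[of w] ne by (auto simp: L_def m_def same_def)
        also have "\<dots> = L u 0 + (\<Sum>v\<in>{1..<n}. (if v = fst_of w then - L u (fst_of w) else 0)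
            + (if v = w then - ((1 + x) * L u w) else 0))"
          using uw w fst_of[of w] by (simp add: sum.distrib sum.delta')
        also have "(\<Sum>v\<in>{1..<n}. (if v = fst_of w then - L u (fst_of w) else 0)
            + (if v = w then - ((1 + x) * L u w) else 0)) = (\<Sum>v\<in>{1..<n}. L u v * T v w)"
          using w False ne by (intro sum.cong refl) (auto simp: T_def algebra_simps)
        also have "L u 0 + \<dots> = (\<Sum>v\<in>{0..<n}. L u v * T v w)"
          unfolding LT using w False by (simp add: T_def)
        finally show ?thesis .
      qed
    qed
    then show "(mat n n (\<lambda>(u, v). m u v) * mat n n (\<lambda>(v, w). U v w)) $$ (u, w)
      = (mat n n (\<lambda>(u, v). L u v) * mat n n (\<lambda>(v, w). T v w)) $$ (u, w)"
      using uw by (simp add: scalar_prod_def)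
  qed auto

  \<comment> \<open>a leader is the least vertex of its clique, so its column vanishes above the diagonal\<close>
  have lead_lower: "\<not> (v > 0 \<and> same v w)" if "lead w" "v < w" "w > 0" for v w
  proof
    assume "v > 0 \<and> same v w"
    then have "fst_of w \<le> v" using fst_of(2)[of v] by (simp add: fst_of_def same_def)
    with fst_of_eq[of w] that show False by simp
  qed
  have "det (mat n n (\<lambda>(v, w). U v w)) = prod_list (diag_mat (mat n n (\<lambda>(v, w). U v w)))"
    by (rule det_lower_triangular[of n]) (use lead_lower in \<open>auto simp: U_def\<close>)
  also have "\<dots> = (\<Prod>v\<in>{0..<n}. if v = 0 then y else 1)"
    unfolding prod_list_diag_prod by (rule prod.cong) (auto simp: U_def same_def)
  also have "\<dots> = y" using n by (simp add: prod.delta')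
  finally have detU: "det (mat n n (\<lambda>(v, w). U v w)) = y" .
  have "det (mat n n (\<lambda>(v, w). L v w)) = prod_list (diag_mat (mat n n (\<lambda>(v, w). L v w)))"
    by (rule det_lower_triangular[of n]) (use lead_lower in \<open>auto simp: L_def\<close>)
  also have "\<dots> = 1"
    unfolding prod_list_diag_prod by (auto simp: L_def same_def intro!: prod.neutral)
  finally have detL: "det (mat n n (\<lambda>(v, w). L v w)) = 1" .
  have "det (mat n n (\<lambda>(v, w). T v w)) = prod_list (diag_mat (mat n n (\<lambda>(v, w). T v w)))"
    by (rule det_upper_triangular[of _ n])
      (auto simp: upper_triangular_def T_def dest: fst_of(2))
  also have "\<dots> = (\<Prod>v\<in>{0..<n}. T v v)"
    unfolding prod_list_diag_prod by (rule prod.cong) auto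
  also have "\<dots> = T 0 0 * (\<Prod>v<k * s. T (Suc v) (Suc v))"
    unfolding n by (simp add: atLeast0LessThan prod.lessThan_Suc_shift del: prod.lessThan_Suc)
  also have "(\<Prod>v<k * s. T (Suc v) (Suc v)) = (\<Prod>v<k * s. if s dvd v then - y else - (1 + x))"
    by (intro prod.cong refl) (simp add: T_def lead_def)
  also have "\<dots> = (- y) ^ k * (- (1 + x)) ^ (k * (s - 1))" using s by (rule prod_if_dvd)
  finally have detT: "det (mat n n (\<lambda>(v, w). T v w)) =
      \<delta> * (- y) ^ k * (- (1 + x)) ^ (k * (s - 1))"
    by (simp add: T_def mult.assoc)
  have "det (mat n n (\<lambda>(u, v). m u v)) * det (mat n n (\<lambda>(v, w). U v w))
    = det (mat n n (\<lambda>(v, w). L v w)) * det (mat n n (\<lambda>(v, w). T v w))"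
    using arg_cong[OF prod_eq, of det] by (simp add: det_mult[of _ n])
  then show ?thesis unfolding detU detL detT M \<delta>_def by (simp add: mult.commute)
qed

section \<open>Coefficients of products of two binomial powers\<close>

lemma coeff_quadratic_mult:
  fixes q :: "real poly"
  shows "coeff ([:a, b, c:] * q) i = a * coeff q i + (if i \<ge> 1 then b * coeff q (i - 1) else 0)
    + (if i \<ge> 2 then c * coeff q (i - 2) else 0)"
proof -
  have "[:a, b, c:] * q = smult a q + pCons 0 (smult b q + pCons 0 (smult c q))"
    by simp
  then show ?thesis
    by (auto simp: coeff_pCons split: nat.split)
qed

lemma linear_power_coeff_pos:
  fixes p :: "real poly"
  assumes "c > 0" "\<And>i. i \<le> degree p \<Longrightarrow> coeff p i > 0" "i \<le> degree p + n"
  shows "coeff ([:c, 1:] ^ n * p) i > 0"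
  using assms(3)
proof (induction n arbitrary: i)
  case 0
  then show ?case using assms(2) by simp
next
  case (Suc n)
  let ?q = "[:c, 1:] ^ n * p"
  have "p \<noteq> 0" using assms(2)[of 0] by auto
  then have deg: "degree ?q = n + degree p"
    by (subst degree_mult_eq) (simp_all add: degree_linear_power)
  have coeff: "coeff ([:c, 1:] ^ Suc n * p) i = c * coeff ?q i + (if i \<ge> 1 then coeff ?q (i - 1) else 0)"
    unfolding power_Suc mult.assoc using coeff_quadratic_mult[of c 1 0 ?q i] by simp
  show ?case
  proof (cases "i \<le> degree p + n")
    case True
    then have "0 < c * coeff ?q i" "i \<ge> 1 \<Longrightarrow> 0 < coeff ?q (i - 1)"
      using Suc.IH assms(1) by simp_all
    then show ?thesis unfolding coeff by (simp add: add_pos_pos)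
  next
    case False
    with Suc.prems have i: "i = Suc (degree p + n)" by simp
    then have "coeff ?q i = 0" by (intro coeff_eq_0) (simp add: deg)
    then show ?thesis unfolding coeff using Suc.IH[of "i - 1"] i by simp
  qed
qed

definition binomial_product :: "nat \<Rightarrow> nat \<Rightarrow> real \<Rightarrow> real poly" where
  "binomial_product A B \<tau> = [:1, 1:] ^ A * [:\<tau>, 1:] ^ B"

text \<open>
  Replacing all three of \<open>b (i - 1)\<close>, \<open>b i\<close>, \<open>b (i + 1)\<close> by
  \<open>1\<close> in the recurrence for the coefficients \<open>b\<close> of a binomial product leaves this
  amount as the excess of the right-hand side over the left-hand side. It is linear in \<open>i\<close> and
  changes sign within a bounded distance of the mean \<open>A / 2 + B / (1 + \<tau>)\<close> of the distribution
  with weights \<open>b\<close>.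
\<close>

definition binomial_drift :: "nat \<Rightarrow> nat \<Rightarrow> real \<Rightarrow> nat \<Rightarrow> real" where
  "binomial_drift A B \<tau> i =
     real A * (1 + \<tau>) + 2 * real B + 1 - \<tau> - 2 * (1 + \<tau>) * real i"

context
  fixes A B :: nat and \<tau> :: real and f :: "real poly" and b drift :: "nat \<Rightarrow> real"
  assumes tau: "\<tau> > 0"
  defines "f \<equiv> binomial_product A B \<tau>"
    and "b \<equiv> coeff (binomial_product A B \<tau>)"
    and "drift \<equiv> binomial_drift A B \<tau>"
begin

lemma degree_binomial_product: "degree f = A + B"
  unfolding f_def b_def binomial_product_def
  by (subst degree_mult_eq) (simp_all add: degree_linear_power)

lemma coeff_binomial_product_pos: "i \<le> A + B \<Longrightarrow> b i > 0"
  unfolding f_def b_def binomial_product_def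
proof (rule linear_power_coeff_pos)
  show "coeff ([:\<tau>, 1:] ^ B) i > 0" if "i \<le> degree ([:\<tau>, 1:] ^ B)" for i
    using linear_power_coeff_pos[of \<tau> 1 i B] that tau by (simp add: degree_linear_power)
qed (simp_all add: degree_linear_power add.commute)

lemma coeff_binomial_product_eq_0: "i > A + B \<Longrightarrow> b i = 0"
  using degree_binomial_product unfolding b_def f_def by (simp add: coeff_eq_0)

lemma real_rooted_binomial_product: "real_rooted f"
proof -
  have "real_rooted [:c, 1:]" for c
    using real_rooted.linear[OF real_rooted.const[of 1], of "- c"] by (simp add: one_pCons)
  then show ?thesis unfolding f_def b_def binomial_product_def
    by (intro real_rooted_mult real_rooted_power)
qed

lemma coeff_binomial_product_log_concave: "b i * b (i + 2) \<le> (b (i + 1))\<^sup>2"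
  using real_rooted_log_concave[OF real_rooted_binomial_product] unfolding b_def f_def .

text \<open>
  The differential equation \<open>f' / f = A / (1 + x) + B / (\<tau> + x)\<close>, cleared of denominators. It
  yields a recurrence of order two for the coefficients.
\<close>

lemma pderiv_binomial_product:
  "[:\<tau>, 1 + \<tau>, 1:] * pderiv f
    = [:real A * \<tau> + real B, real A + real B:] * f"
proof -
  have power: "p * pderiv (p ^ n) = smult (real n) (p ^ n * pderiv p)" for p :: "real poly" and n
  proof (cases n)
    case (Suc m)
    show ?thesis unfolding Suc pderiv_power_Suc by (simp add: mult_ac)
  qed simp
  let ?p = "[:1, 1:] :: real poly" and ?q = "[:\<tau>, 1:]"
  have "[:\<tau>, 1 + \<tau>, 1:] = ?p * ?q" by simp
  then have "[:\<tau>, 1 + \<tau>, 1:] * pderiv f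
      = ?q * ?q ^ B * (?p * pderiv (?p ^ A)) + ?p * ?p ^ A * (?q * pderiv (?q ^ B))"
    unfolding f_def b_def binomial_product_def pderiv_mult by (simp only: algebra_simps)
  also have "\<dots> = (smult (real A) ?q + smult (real B) ?p) * f"
  proof -
    have deriv: "pderiv [:c, 1:] = 1" for c :: real by (simp add: pderiv_pCons one_pCons)
    show ?thesis unfolding power f_def binomial_product_def deriv
      by (simp only: mult_1_right mult_1_left mult_smult_left mult_smult_right distrib_right
          distrib_left mult_ac)
  qed
  finally show ?thesis by (simp add: algebra_simps)
qed

lemma coeff_binomial_product_recurrence:
  "\<tau> * (real i + 2) * b (i + 2)
    = (real A * \<tau> + real B - (1 + \<tau>) * (real i + 1)) * b (i + 1) + (real A + real B - real i) * b i"
proof -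
  have linear: "[:real A * \<tau> + real B, real A + real B:] = [:real A * \<tau> + real B, real A + real B, 0:]"
    by simp
  from arg_cong[OF pderiv_binomial_product, of "\<lambda>p. coeff p (i + 1)"] show ?thesis
    unfolding linear coeff_quadratic_mult b_def f_def by (cases i) (simp_all add: coeff_pderiv algebra_simps)
qed

text \<open>
  The quotients \<open>b i / b (i + 1)\<close> do not decrease, by log-concavity, so the last one, which the
  recurrence at the upper end of the sequence computes, bounds them all.
\<close>

lemma coeff_binomial_product_ratio:
  assumes "i < A + B"
  shows "b i \<le> (real A + real B * \<tau>) * b (i + 1)"
proof -
  have "i \<le> A + B - 1" using assms by simp
  then show ?thesis
  proof (induction i rule: inc_induct)
    case base
    have "b (A + B + 1) = 0" by (rule coeff_binomial_product_eq_0) simp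
    moreover have "A + B - 1 + 2 = A + B + 1" "A + B - 1 + 1 = A + B"
      "real (A + B - 1) = real A + real B - 1" using assms by auto
    ultimately show ?case using coeff_binomial_product_recurrence[of "A + B - 1"] by (simp add: algebra_simps)
  next
    case (step i)
    let ?C = "real A + real B * \<tau>"
    have pos: "b (i + 1) > 0" "b (i + 2) > 0" using step.hyps by (auto intro: coeff_binomial_product_pos)
    have "b i * b (i + 2) \<le> b (i + 1) * b (i + 1)"
      using coeff_binomial_product_log_concave[of i] by (simp add: power2_eq_square)
    also have "\<dots> \<le> b (i + 1) * (?C * b (i + 2))"
      using step.IH pos by (intro mult_left_mono) auto
    finally have "b i * b (i + 2) \<le> (?C * b (i + 1)) * b (i + 2)" by (simp add: algebra_simps)
    then show ?case using pos by (simp only: mult_le_cancel_right_pos)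
  qed
qed

text \<open>
  Multiplying the recurrence by \<open>b i\<close> and estimating \<open>b i * b (i + 2)\<close> by
  log-concavity leaves a quadratic inequality in \<open>b i\<close> and \<open>b (i + 1)\<close> alone. It
  factors through \<open>b (i + 1) - b i\<close>, up to the drift. The quantitative form is needed later to
  absorb the negative coefficient of the quadratic factor.
\<close>

lemma coeff_binomial_product_increase:
  assumes "i < A + B" "drift (i + 1) > 0"
  shows "drift (i + 1) * b i \<le> (1 + \<tau>) * (real A + real B + 1) * (b (i + 1) - b i)"
    and "b i < b (i + 1)"
proof -
  let ?E = "drift (i + 1)" and ?T = "\<tau> * (real i + 2)" and ?Q = "real A + real B - real i"
  have pos: "b i > 0" "b (i + 1) > 0" using assms(1) by (auto intro: coeff_binomial_product_pos)
  have "?T * (b i * b (i + 2)) \<le> ?T * (b (i + 1))\<^sup>2"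
    using tau by (intro mult_left_mono coeff_binomial_product_log_concave) simp
  moreover have "?T * (b i * b (i + 2)) = b i * (?T * b (i + 2))" by (simp only: mult_ac)
  ultimately have "?E * (b i * b (i + 1)) \<le> (b (i + 1) - b i) * (?T * b (i + 1) + ?Q * b i)"
    unfolding coeff_binomial_product_recurrence by (simp add: drift_def binomial_drift_def algebra_simps power2_eq_square)
  moreover have T: "?T * b (i + 1) + ?Q * b i > 0"
  proof -
    have "?T > 0" "?Q > 0" using tau assms(1) by simp_all
    with pos show ?thesis by (intro add_pos_pos) (simp_all only: mult_pos_pos)
  qed
  moreover have "?E * (b i * b (i + 1)) > 0" using assms(2) pos by simp
  ultimately show less: "b i < b (i + 1)"
    by (smt (verit) mult_nonpos_nonneg)
  have "?T * b (i + 1) + ?Q * b i \<le> ?T * b (i + 1) + ?Q * b (i + 1)"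
    using less assms(1) by (intro add_left_mono mult_left_mono) auto
  also have "\<dots> = (?T + ?Q) * b (i + 1)" by (simp add: algebra_simps)
  also have "\<dots> \<le> ((1 + \<tau>) * (real A + real B + 1)) * b (i + 1)"
  proof (rule mult_right_mono)
    have "?T \<le> \<tau> * (real A + real B + 1)" using tau assms(1) by (intro mult_left_mono) auto
    then show "?T + ?Q \<le> (1 + \<tau>) * (real A + real B + 1)" by (simp add: algebra_simps)
  qed (use pos in simp)
  finally have "(b (i + 1) - b i) * (?T * b (i + 1) + ?Q * b i)
      \<le> (b (i + 1) - b i) * (((1 + \<tau>) * (real A + real B + 1)) * b (i + 1))"
    using less by (intro mult_left_mono) auto
  with \<open>?E * (b i * b (i + 1)) \<le> _\<close>
  have "(?E * b i) * b (i + 1) \<le> ((1 + \<tau>) * (real A + real B + 1) * (b (i + 1) - b i)) * b (i + 1)"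
    by (simp add: algebra_simps)
  then show "?E * b i \<le> (1 + \<tau>) * (real A + real B + 1) * (b (i + 1) - b i)"
    using pos by (simp only: mult_le_cancel_right_pos)
qed

text \<open>
  The same argument with the recurrence multiplied by \<open>b (i + 2)\<close>, so that log-concavity bounds
  \<open>b i * b (i + 2)\<close> where it occurs with a positive factor.
\<close>

lemma coeff_binomial_product_decrease:
  assumes "i + 1 < A + B" "drift (i + 1) < 0"
  shows "b (i + 2) < b (i + 1)"
proof -
  let ?E = "drift (i + 1)" and ?T = "\<tau> * (real i + 2)" and ?Q = "real A + real B - real i"
  have pos: "b (i + 1) > 0" "b (i + 2) > 0" using assms(1) by (auto intro: coeff_binomial_product_pos)
  have "?Q * (b i * b (i + 2)) \<le> ?Q * (b (i + 1))\<^sup>2"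
    using assms(1) by (intro mult_left_mono coeff_binomial_product_log_concave) simp
  moreover have "?T * b (i + 2) * b (i + 2)
      = (real A * \<tau> + real B - (1 + \<tau>) * (real i + 1)) * b (i + 1) * b (i + 2) + ?Q * (b i * b (i + 2))"
    unfolding coeff_binomial_product_recurrence by (simp add: algebra_simps)
  ultimately have "(b (i + 2) - b (i + 1)) * (?T * b (i + 2) + ?Q * b (i + 1)) \<le> ?E * (b (i + 1) * b (i + 2))"
    by (simp add: drift_def binomial_drift_def algebra_simps power2_eq_square)
  moreover have "?E * (b (i + 1) * b (i + 2)) < 0"
    using assms(2) pos by (simp add: mult_neg_pos)
  moreover have "?T * b (i + 2) + ?Q * b (i + 1) > 0"
  proof -
    have "?T > 0" "?Q > 0" using tau assms(1) by simp_all
    with pos show ?thesis by (intro add_pos_pos) (simp_all only: mult_pos_pos)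
  qed
  ultimately show ?thesis by (smt (verit) mult_nonneg_nonneg)
qed

end

section \<open>Coefficients of the characteristic polynomial\<close>

text \<open>
  The determinant formula over the polynomial ring, with \<open>x\<close> the indeterminate. There the factor
  \<open>y = x + t\<close> is not a zero divisor and can be cancelled against one of the \<open>k\<close>
  factors \<open>- y\<close>.
\<close>

lemma det_minus_xI_windmill:
  assumes "t \<ge> 2" "k \<ge> 1"
  shows "det_minus_xI (distance_matrix (with_proj (windmill k t))) = (- 1) ^ (k * (t - 1)) *
    ([:real (k * (t - 1)), 2 * real (k * (t - 1)) - real t, - 1:] * binomial_product (k * (t - 2)) (k - 1) (real t))"
proof -
  define s where "s = t - 1"
  define n where "n = k * s + 1"
  define X :: "real poly" where "X = [:0, 1:]"
  define y where "y = X + of_nat s + 1"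
  have s: "s \<ge> 1" and t: "t = s + 1" using assms(1) by (auto simp: s_def)
  have card: "card (verts (with_proj (windmill k t))) = n"
    by (simp add: windmill_def n_def s_def)
  let ?M = "mat n n (\<lambda>(u, v). if u = v then - X
    else if u = 0 \<or> v = 0 \<or> (u - 1) div s = (v - 1) div s then 1 else 2)"
  have "map_mat (\<lambda>a. [:a:]) (distance_matrix (with_proj (windmill k t)))
      - [:0, 1:] \<cdot>\<^sub>m 1\<^sub>m (dim_row (distance_matrix (with_proj (windmill k t)))) = ?M"
    unfolding distance_matrix_def card
    by (rule eq_matI)
      (auto simp: X_def graph_dist_windmill[OF assms] n_def s_def one_pCons numeral_poly)
  then have M: "det_minus_xI (distance_matrix (with_proj (windmill k t))) = det ?M"
    unfolding det_minus_xI_def by simp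
  have y: "y = [:real t, 1:]"
    by (simp add: y_def X_def t of_nat_poly one_pCons)
  have one_X: "1 + X = [:1, 1:]" by (simp add: X_def one_pCons)
  have quad: "of_nat (k * s) * (1 + 2 * X) - X * y
      = [:real (k * s), 2 * real (k * s) - real t, - 1:]"
    by (simp add: y X_def of_nat_poly one_pCons numeral_poly algebra_simps)
  have exponents: "k * (s - 1) = k * (t - 2)" and sign: "k + k * (s - 1) = k * s"
    using s by (cases s; simp add: t)+
  have "y * det ?M = (of_nat (k * s) * (1 + 2 * X) - X * y) * (- y) ^ k
      * (- (1 + X)) ^ (k * (s - 1))"
    unfolding y_def by (rule det_windmill_matrix[OF s n_def])
  also have "(- y) ^ k = y * ((- 1) ^ k * y ^ (k - 1))"
    using assms(2) by (subst power_minus) (cases k; simp)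
  also have "(- (1 + X)) ^ (k * (s - 1)) = (- 1) ^ (k * (s - 1)) * (1 + X) ^ (k * (s - 1))"
    by (rule power_minus)
  finally have "y * det ?M = y * ((- 1) ^ (k + k * (s - 1)) *
      ((of_nat (k * s) * (1 + 2 * X) - X * y) * ((1 + X) ^ (k * (s - 1)) * y ^ (k - 1))))"
    by (simp add: power_add algebra_simps)
  moreover have "y \<noteq> 0" by (simp add: y)
  ultimately have "det ?M = (- 1) ^ (k * s) *
      ((of_nat (k * s) * (1 + 2 * X) - X * y) * ((1 + X) ^ (k * (s - 1)) * y ^ (k - 1)))"
    unfolding sign by (simp only: mult_cancel_left) simp
  then show ?thesis
    unfolding M quad unfolding one_X y exponents binomial_product_def unfolding s_def .
qed


lemma real_rooted_quadratic:
  assumes "a > 0"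
  shows "real_rooted [:a, c, - 1:]"
proof (rule real_rootedI)
  fix z assume "poly (complex_poly [:a, c, - 1:]) z = 0"
  then have "Re (poly (complex_poly [:a, c, - 1:]) z) = 0" "Im (poly (complex_poly [:a, c, - 1:]) z) = 0"
    by simp_all
  then have re: "a + Re z * (c - Re z) + Im z * Im z = 0" and im: "Im z * (c - 2 * Re z) = 0"
    by (simp_all add: map_poly_pCons algebra_simps)
  show "Im z = 0"
  proof (rule ccontr)
    assume "Im z \<noteq> 0"
    with im have "c - Re z = Re z" by simp
    with re assms show False using zero_le_square[of "Re z"] zero_le_square[of "Im z"] by simp
  qed
qed simp
context
  fixes k t N A B :: nat and C :: real and a b :: "nat \<Rightarrow> real"
  assumes t: "t \<ge> 3" and k: "k \<ge> 2"
  defines "A \<equiv> k * (t - 2)" and "B \<equiv> k - 1"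
  defines "b \<equiv> coeff (binomial_product A B (real t))"
  defines "N \<equiv> k * (t - 1) - 1"
  defines "C \<equiv> 2 * real (k * (t - 1)) - real t"
  defines "a \<equiv> coeff ([:real (k * (t - 1)), C, - 1:] * binomial_product A B (real t))"
begin

lemma t_pos: "real t > 0" using t by simp

lemma windmill_parameters: "N = A + B" "real A + real B + 1 = real (k * (t - 1))" "real A + real B * real t = C"
proof -
  obtain t' where t': "t = 3 + t'" using le_Suc_ex[OF t] by blast
  obtain k' where k': "k = 2 + k'" using le_Suc_ex[OF k] by blast
  show "N = A + B" "real A + real B + 1 = real (k * (t - 1))" "real A + real B * real t = C"
    unfolding N_def A_def B_def C_def t' k' by (simp_all add: algebra_simps)
qed

lemma windmill_drift: "binomial_drift A B (real t) i
    = real k * real t * (real t - 1) - (1 + real t) - 2 * (1 + real t) * real i"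
proof -
  have AB: "real A = real k * (real t - 2)" "real B = real k - 1"
    using t k unfolding A_def B_def by (simp_all add: of_nat_diff)
  show ?thesis unfolding binomial_drift_def AB by (simp add: algebra_simps)
qed

lemma windmill_linear_coeff_ge: "C \<ge> real (k * (t - 1))"
proof -
  have "2 * (t - 1) \<le> k * (t - 1)" using k by (rule mult_le_mono1)
  then have "t \<le> k * (t - 1)" using t by linarith
  then have "real t \<le> real (k * (t - 1))" by (simp only: of_nat_le_iff)
  then show ?thesis unfolding C_def by linarith
qed

lemmas windmill_factor_facts = coeff_binomial_product_pos[OF t_pos, of _ A B, folded b_def windmill_parameters(1)]
  coeff_binomial_product_log_concave[OF t_pos, of A B, folded b_def]
  coeff_binomial_product_ratio[OF t_pos, of _ A B, folded b_def windmill_parameters(1)]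

lemma windmill_coeff_eq: "a i = real (k * (t - 1)) * b i + (if i \<ge> 1 then C * b (i - 1) else 0)
    - (if i \<ge> 2 then b (i - 2) else 0)"
  unfolding a_def b_def coeff_quadratic_mult by simp

text \<open>
  The only negative contribution is \<open>- b (i - 2)\<close>. Since \<open>C\<close> equals \<open>A + B *
  t\<close>, the bound on the quotients of neighbouring coefficients says that \<open>C * b (i - 1)\<close>
  outweighs it.
\<close>

lemma windmill_coeff_pos:
  assumes "i \<le> N"
  shows "a i > 0"
proof -
  have "real (k * (t - 1)) * b i > 0" using windmill_factor_facts(1)[OF assms] k t by simp
  moreover have "(if i \<ge> 1 then C * b (i - 1) else 0) - (if i \<ge> 2 then b (i - 2) else 0) \<ge> 0"
  proof (cases "i \<ge> 2")
    case True
    then have "i - 2 + 1 = i - 1" by simp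
    then show ?thesis using windmill_factor_facts(3)[of "i - 2"] True assms windmill_parameters(3) by simp
  next
    case False
    have "C \<ge> 0" using windmill_linear_coeff_ge by (rule order_trans[rotated]) simp
    then show ?thesis using False windmill_factor_facts(1)[of 0] by (auto simp: not_le less_Suc_eq numeral_2_eq_2)
  qed
  ultimately show ?thesis unfolding windmill_coeff_eq by linarith
qed

lemma windmill_coeff_unimodal: "unimodal a N"
proof (rule log_concave_unimodal)
  have "real_rooted ([:real (k * (t - 1)), C, - 1:] * binomial_product A B (real t))"
    using t k by (intro real_rooted_mult real_rooted_quadratic real_rooted_binomial_product) auto
  then show "a i * a (i + 2) \<le> (a (i + 1))\<^sup>2" for i
    unfolding a_def by (rule real_rooted_log_concave)
qed (rule windmill_coeff_pos)

text \<open>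
  The difference \<open>a (i + 1) - a i\<close> combines three successive increments of \<open>b\<close>, of
  which the oldest, \<open>b (i - 1) - b (i - 2)\<close>, has a negative coefficient. It is less than \<open>b
  (i - 1)\<close>, whereas the middle one, of weight \<open>C \<ge> k (t - 1)\<close>, is at least \<open>b (i -
  1) / (k (t - 1))\<close> as soon as the drift at \<open>i\<close> is at least \<open>1 + t\<close>.
\<close>

lemma windmill_coeff_increase:
  assumes "i \<ge> 2" "i < N" "binomial_drift A B (real t) (i + 1) > 0"
  shows "a i < a (i + 1)"
proof -
  let ?K = "real (k * (t - 1))"
  obtain j where i: "i = j + 2" using le_Suc_ex[OF assms(1)] by (auto simp: add.commute)
  note inc = coeff_binomial_product_increase[OF t_pos, of _ A B, folded b_def windmill_parameters(1)]
  have drift: "binomial_drift A B (real t) (j + 2) = binomial_drift A B (real t) (i + 1) + 2 * (1 + real t)"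
    unfolding windmill_drift i by (simp add: algebra_simps)
  with assms(3) have drift_pos: "binomial_drift A B (real t) (j + 1 + 1) > 0" by (simp add: add_pos_pos)
  have "b i < b (i + 1)" using inc(2)[OF assms(2,3)] .
  moreover have "?K > 0" using k t by simp
  ultimately have "?K * b i < ?K * b (i + 1)" by (rule mult_strict_left_mono)
  have j: "j + 1 < N" "j < N" using assms(2) i by auto
  have pos: "b j > 0" "b (j + 1) > 0" using j by (auto intro: windmill_factor_facts(1))
  have less: "b (j + 1) < b (j + 2)" using inc(2)[OF j(1) drift_pos] by simp
  have "(1 + real t) * b (j + 1) \<le> binomial_drift A B (real t) (j + 2) * b (j + 1)"
    using drift assms(3) pos by (intro mult_right_mono) auto
  also have "\<dots> \<le> (1 + real t) * (?K * (b (j + 2) - b (j + 1)))"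
    using inc(1)[OF j(1) drift_pos] unfolding windmill_parameters(2) by (simp add: mult.assoc)
  finally have "b (j + 1) \<le> ?K * (b (j + 2) - b (j + 1))"
    using t by (simp add: mult_le_cancel_left)
  also have "\<dots> \<le> C * (b (j + 2) - b (j + 1))"
    using windmill_linear_coeff_ge less by (intro mult_right_mono) auto
  finally have "b (j + 1) - b j < C * b (j + 2) - C * b (j + 1)"
    using pos by (simp add: algebra_simps)
  with \<open>?K * b i < ?K * b (i + 1)\<close> show ?thesis
    unfolding windmill_coeff_eq i by (simp add: eval_nat_numeral algebra_simps)
qed

text \<open>
  Here log-concavity bounds \<open>b (i - 2) - b (i - 1)\<close> by the next decrement times \<open>b (i - 1) /
  b i\<close>, and this quotient is at most \<open>C\<close>.
\<close>

lemma windmill_coeff_decrease: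
  assumes "i \<ge> 2" "i < N" "binomial_drift A B (real t) (i - 1) < 0"
  shows "a (i + 1) < a i"
proof -
  let ?K = "real (k * (t - 1))"
  obtain j where i: "i = j + 2" using le_Suc_ex[OF assms(1)] by (auto simp: add.commute)
  note dec = coeff_binomial_product_decrease[OF t_pos, of _ A B, folded b_def windmill_parameters(1)]
  have drift: "binomial_drift A B (real t) (j + 1) < 0" using assms(3) i by simp
  then have drift': "binomial_drift A B (real t) (j + 1 + 1) < 0"
    unfolding windmill_drift by (simp add: algebra_simps)
  have j: "j + 1 < N" "j + 1 + 1 < N" "j + 2 \<le> N" using assms(2) i by auto
  have pos: "b (j + 1) > 0" "b (j + 2) > 0" using j by (auto intro: windmill_factor_facts(1))
  have "b (j + 3) < b (j + 2)" using dec[OF j(2) drift'] by (simp add: eval_nat_numeral)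
  moreover have "?K > 0" using k t by simp
  ultimately have 1: "?K * b (j + 3) < ?K * b (j + 2)" by (rule mult_strict_left_mono)
  have less: "b (j + 2) < b (j + 1)" using dec[OF j(1) drift] .
  have "(b j - b (j + 1)) * b (j + 2) \<le> b (j + 1) * (b (j + 1) - b (j + 2))"
    using windmill_factor_facts(2)[of j] by (simp add: algebra_simps power2_eq_square)
  also have "\<dots> \<le> (C * b (j + 2)) * (b (j + 1) - b (j + 2))"
    using windmill_factor_facts(3)[of "j + 1"] j less unfolding windmill_parameters(3)
    by (intro mult_right_mono) (simp_all add: eval_nat_numeral)
  finally have "(b j - b (j + 1)) * b (j + 2) \<le> (C * (b (j + 1) - b (j + 2))) * b (j + 2)"
    by (simp add: algebra_simps)
  then have "b j - b (j + 1) \<le> C * (b (j + 1) - b (j + 2))"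
    using pos by (simp only: mult_le_cancel_right_pos)
  with 1 show ?thesis unfolding windmill_coeff_eq i by (simp add: eval_nat_numeral algebra_simps)
qed

text \<open>
  The drift is \<open>2 (1 + t) (\<mu> - 1 / 2 - i)\<close> with \<open>\<mu>\<close> the asserted position, so
  the coefficients increase strictly up to a bounded distance before \<open>\<mu>\<close> and decrease strictly
  from a bounded distance after it. A peak can only lie in between.
\<close>

lemma windmill_peak_bound:
  assumes "unimodal_with_peak a N m"
  shows "\<bar>real m - real k * real t * (real t - 1) / (2 * (real t + 1))\<bar> \<le> 4"
proof -
  define \<mu> where "\<mu> = real k * real t * (real t - 1) / (2 * (real t + 1))"
  have m: "m \<le> N" and up: "\<And>i. 1 \<le> i \<Longrightarrow> i \<le> m \<Longrightarrow> a (i - 1) \<le> a i"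
    and down: "\<And>i. m \<le> i \<Longrightarrow> i < N \<Longrightarrow> a (i + 1) \<le> a i"
    using assms unfolding unimodal_with_peak_def by auto
  have drift: "binomial_drift A B (real t) i = 2 * (1 + real t) * (\<mu> - 1 / 2 - real i)" for i
  proof -
    have "(2 * (real t + 1)) * \<mu> = real k * real t * (real t - 1)"
      unfolding \<mu>_def by simp
    then show ?thesis unfolding windmill_drift by (simp add: algebra_simps)
  qed
  have \<mu>_nonneg: "\<mu> \<ge> 0" unfolding \<mu>_def using t by simp
  have "\<mu> \<le> real (k * (t - 1))"
  proof -
    have "\<mu> = (real k * (real t - 1)) * (real t / (2 * (real t + 1)))"
      unfolding \<mu>_def by simp
    also have "\<dots> \<le> (real k * (real t - 1)) * 1"
      using t by (intro mult_left_mono) auto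
    finally show ?thesis using t by (simp add: of_nat_diff)
  qed
  also have "\<dots> = real N + 1" using windmill_parameters by simp
  finally have \<mu>_le: "\<mu> \<le> real N + 1" .
  have "\<mu> \<le> real m + 4"
  proof (rule ccontr)
    assume "\<not> ?thesis"
    \<comment> \<open>the increase is available only from index \<open>2\<close> on\<close>
    define i where "i = max m 2"
    have i: "real i \<le> real m + 2" unfolding i_def by simp
    have "binomial_drift A B (real t) (i + 1) > 0"
      unfolding drift using i \<open>\<not> _\<close> by (intro mult_pos_pos) auto
    moreover have "i < N" using i \<mu>_le \<open>\<not> _\<close> by linarith
    moreover have "i \<ge> 2" "i \<ge> m" unfolding i_def by auto
    ultimately show False using windmill_coeff_increase[of i] down[of i] by simp
  qed
  moreover have "real m \<le> \<mu> + 4"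
  proof (rule ccontr)
    assume m_gt: "\<not> ?thesis"
    with \<mu>_nonneg have "m > 4" by linarith
    then have "real (m - 1 - 1) = real m - 2" by simp
    with m_gt have "binomial_drift A B (real t) (m - 1 - 1) < 0"
      unfolding drift by (intro mult_pos_neg) auto
    moreover have "m - 1 \<ge> 2" "m - 1 < N" "m - 1 + 1 = m" using m \<open>m > 4\<close> by linarith+
    moreover have "a (m - 1) \<le> a m" using \<open>m > 4\<close> by (intro up) auto
    ultimately show False using windmill_coeff_decrease[of "m - 1"] by simp
  qed
  ultimately show ?thesis unfolding \<mu>_def by linarith
qed

end


theorem theorem4p3:
  fixes t :: nat
    and n :: "nat \<Rightarrow> nat"
    and c a :: "nat \<Rightarrow> nat \<Rightarrow> real"
  assumes "t \<ge> 3"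
  defines "n \<equiv> \<lambda>k. k * (t - 1) + 1"
    and "c \<equiv> \<lambda>k i. coeff (det_minus_xI (distance_matrix (with_proj (windmill k t)))) i"
    and "a \<equiv> \<lambda>k i. (- 1) ^ (n k - 1) * c k i"
  shows "(\<forall>k\<ge>2. unimodal (a k) (n k - 2)) \<and>
    (\<forall>peak :: nat \<Rightarrow> nat.
       (\<forall>k\<ge>2. unimodal_with_peak (a k) (n k - 2) (peak k)) \<longrightarrow>
       (\<lambda>k. real (peak k) - real k * real t * (real t - 1) / (2 * (real t + 1)))
         \<in> O(\<lambda>k. ln (real k)))"
proof (intro conjI allI impI)
  have a: "a k = coeff ([:real (k * (t - 1)), 2 * real (k * (t - 1)) - real t, - 1:] *
      binomial_product (k * (t - 2)) (k - 1) (real t))" if "k \<ge> 2" for k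
  proof
    fix i
    have sign: "(- 1) ^ m * p = smult ((- 1) ^ m) p" for m and p :: "real poly"
      by (induction m) simp_all
    have sq: "(- 1) ^ m * ((- 1) ^ m * x) = (x :: real)" for m x
      by (simp flip: mult.assoc power_mult_distrib)
    have n: "n k - 1 = k * (t - 1)" by (simp add: n_def)
    have "det_minus_xI (distance_matrix (with_proj (windmill k t))) = smult ((- 1) ^ (n k - 1))
      ([:real (k * (t - 1)), 2 * real (k * (t - 1)) - real t, - 1:] *
        binomial_product (k * (t - 2)) (k - 1) (real t))"
      unfolding n sign[symmetric] using assms(1) that by (intro det_minus_xI_windmill) auto
    then show "a k i = coeff ([:real (k * (t - 1)), 2 * real (k * (t - 1)) - real t, - 1:] *
      binomial_product (k * (t - 2)) (k - 1) (real t)) i"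
      unfolding a_def c_def by (simp only: coeff_smult sq)
  qed
  have n: "n k - 2 = k * (t - 1) - 1" for k unfolding n_def by simp
  show "unimodal (a k) (n k - 2)" if "k \<ge> 2" for k
    unfolding a[OF that] n by (rule windmill_coeff_unimodal[OF assms(1) that])
  fix peak :: "nat \<Rightarrow> nat"
  assume peak: "\<forall>k\<ge>2. unimodal_with_peak (a k) (n k - 2) (peak k)"
  show "(\<lambda>k. real (peak k) - real k * real t * (real t - 1) / (2 * (real t + 1)))
      \<in> O(\<lambda>k. ln (real k))"
  proof (rule bigoI)
    show "\<forall>\<^sub>F k in sequentially.
        norm (real (peak k) - real k * real t * (real t - 1) / (2 * (real t + 1)))
        \<le> 4 / ln 2 * norm (ln (real k))"
      using eventually_ge_at_top[of 2]
    proof eventually_elim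
      case (elim k)
      have "\<bar>real (peak k) - real k * real t * (real t - 1) / (2 * (real t + 1))\<bar> \<le> 4"
        using peak[rule_format, OF elim] unfolding a[OF elim] n
        by (rule windmill_peak_bound[OF assms(1) elim])
      \<comment> \<open>a bounded error is \<open>O(log k)\<close> because \<open>ln k \<ge> ln 2 > 0\<close>\<close>
      also have "4 = 4 / ln 2 * ln (2 :: real)" by simp
      also have "\<dots> \<le> 4 / ln 2 * ln (real k)"
        using elim by (intro mult_left_mono) auto
      finally show ?case using elim by simp
    qed
  qed
qed

end
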